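(* For every integer $k \ge 4$ and every integer $\ell \ge 1$ there exists a finite point set $X_{k,\ell}\subset\mathbb{R}^k$ such that, when greedy $k$-means++ with parameter $\ell$ is run on $X_{k,\ell}$, the expected approximation ratio $\mathbb{E}[\Phi(X_{k,\ell},C)]/\mathrm{OPT}_k(X_{k,\ell})$ of the computed center set $C$ is $\Omega\big(\min\{\ell, k/\log k\}\cdot \log k\big)$.
   Context: For a finite (multi)set $X\subset\mathbb{R}^d$ and a finite center set $C\subset\mathbb{R}^d$, the $k$-means cost is $\Phi(X,C)=\sum_{x\in X}\min_{c\in C}\|x-c\|^2$, and $\mathrm{OPT}_k(X)=\min_{C\subset\mathbb{R}^d,|C|=k}\Phi(X,C)$. Greedy $k$-means++ with parameter $\ell$ on input $X$ works as follows: sample a point $c_1$ uniformly at random from $X$ and set $C=\{c_1\}$; then for $i=2,\dots,k$: define $p(x)=\min_{c\in C}\|x-c\|^2/\sum_{y\in X}\min_{c\in C}\|y-c\|^2$ for $x\in X$ ($D^2$-sampling), sample a set $S$ of $\ell$ points independently according to $p$, let $c_i=\arg\min_{u\in S}\Phi(X,C\cup\{u\})$, and set $C=C\cup\{c_i\}$. The output is the resulting set $C$ of $k$ centers. *)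

theory Defs
  imports "HOL-Probability.Probability" "Jordan_Normal_Form.Matrix"
begin

text \<open>
  The dimension is bound inside the theorem, after the constant of the asymptotic bound, so
  \<open>\<real>\<^sup>d\<close> is \<open>carrier_vec d\<close> rather than a type of the form \<open>real ^ 'n\<close>.
\<close>

definition sqdist :: "real vec \<Rightarrow> real vec \<Rightarrow> real" where
  "sqdist x y = scalar_prod (x - y) (x - y)"

definition center_sqdist :: "real vec set \<Rightarrow> real vec \<Rightarrow> real" where
  "center_sqdist C x = Min (sqdist x ` C)"

definition kmeans_cost :: "real vec set \<Rightarrow> real vec set \<Rightarrow> real" where
  "kmeans_cost X C = (\<Sum>x\<in>X. center_sqdist C x)"

definition kmeans_opt :: "nat \<Rightarrow> nat \<Rightarrow> real vec set \<Rightarrow> real" where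
  "kmeans_opt d k X = (INF C\<in>{C. C \<subseteq> carrier_vec d \<and> finite C \<and> card C = k}. kmeans_cost X C)"

text \<open>
  If the cost is zero, the \<open>D\<^sup>2\<close> weights are all \<open>0 / 0\<close>; sampling is then uniform by convention.
  This makes no difference when \<open>kmeans_opt d k X > 0\<close> and \<open>C\<close> has at most \<open>k\<close> centers.
\<close>

definition D2_sampling :: "real vec set \<Rightarrow> real vec set \<Rightarrow> real vec pmf" where
  "D2_sampling X C =
    (if kmeans_cost X C = 0 then pmf_of_set X
     else embed_pmf (\<lambda>x. if x \<in> X then center_sqdist C x / kmeans_cost X C else 0))"

lemma center_sqdist_nonneg:
  assumes "finite C" "C \<noteq> {}"
  shows "center_sqdist C x \<ge> 0"
  using assms by (auto simp: center_sqdist_def sqdist_def scalar_prod_def intro!: sum_nonneg)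

lemma pmf_D2_sampling:
  assumes "finite X" "finite C" "C \<noteq> {}" "kmeans_cost X C \<noteq> 0"
  shows "pmf (D2_sampling X C) x =
    (if x \<in> X then center_sqdist C x / kmeans_cost X C else 0)"
proof -
  let ?f = "\<lambda>x. if x \<in> X then center_sqdist C x / kmeans_cost X C else 0"
  have cost: "kmeans_cost X C \<ge> 0"
    unfolding kmeans_cost_def by (intro sum_nonneg center_sqdist_nonneg assms)
  have nonneg: "?f y \<ge> 0" for y
    using cost center_sqdist_nonneg[OF assms(2,3)] by simp
  have "(\<integral>\<^sup>+ y. ennreal (?f y) \<partial>count_space UNIV) = (\<Sum>y\<in>X. ennreal (?f y))"
    by (rule nn_integral_count_space'[OF assms(1)]) auto
  also have "\<dots> = ennreal (\<Sum>y\<in>X. ?f y)"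
    using nonneg by (intro sum_ennreal) blast
  also have "(\<Sum>y\<in>X. ?f y) = (\<Sum>y\<in>X. center_sqdist C y) / kmeans_cost X C"
    by (simp add: sum_divide_distrib)
  also have "\<dots> = 1"
    using assms(4) by (simp add: kmeans_cost_def)
  finally have "pmf (embed_pmf ?f) x = ?f x"
    using nonneg by (intro pmf_embed_pmf) auto
  then show ?thesis
    using assms(4) by (simp add: D2_sampling_def)
qed

text \<open>Ties in the choice of the new center are broken arbitrarily, by the choice operator in
  \<open>arg_min_on\<close>.\<close>

definition greedy_step :: "nat \<Rightarrow> real vec set \<Rightarrow> real vec set \<Rightarrow> real vec set pmf" where
  "greedy_step l X C =
    map_pmf (\<lambda>us. insert (arg_min_on (\<lambda>u. kmeans_cost X (insert u C)) (set us)) C)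
      (replicate_pmf l (D2_sampling X C))"

definition greedy_kmeanspp :: "nat \<Rightarrow> nat \<Rightarrow> real vec set \<Rightarrow> real vec set pmf" where
  "greedy_kmeanspp k l X =
    ((\<lambda>P. bind_pmf P (greedy_step l X)) ^^ (k - 1)) (map_pmf (\<lambda>c. {c}) (pmf_of_set X))"

end

theory Submission
  imports Defs
begin

text \<open>
  On the last coordinate axis take \<open>k\<close> points clustered near the origin and one further point, the
  tip, at distance about \<open>1\<close> from them; add the \<open>k - 1\<close> apexes \<open>a (e\<^sub>i + e\<^sub>k)\<close>. Choosing the origin and
  all apexes costs at most \<open>2\<close>, while missing an apex costs at least \<open>a\<^sup>2\<close>. With probability \<open>1/2\<close> the
  first center lies in the cluster, and then every further center has to be a new apex. The tip is
  slightly closer than the cluster to all apexes at once, so as long as at least \<open>3a\<close> apexes are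
  missing it lowers the cost by more than any single apex and wins whenever it is sampled. With \<open>r\<close>
  missing apexes each sample is the tip with probability at least \<open>1 / (8 a\<^sup>2 r)\<close>, so the greedy
  algorithm finds all apexes with probability at most \<open>exp (- l / (8 a\<^sup>2) * \<Sum> 1 / r)\<close>, the sum over
  \<open>3a \<le> r < k\<close> being of order \<open>ln k\<close> when \<open>a\<^sup>2 \<le> k / 64\<close>. The choice \<open>a\<^sup>2 \<approx> min (l ln k) k\<close> makes a miss
  have constant probability and cost of the required order.
\<close>

section \<open>Squared distances and costs\<close>

lemma sqdist_altdef:
  assumes "x \<in> carrier_vec d" "y \<in> carrier_vec d"
  shows "sqdist x y = (\<Sum>i<d. (vec_index x i - vec_index y i)\<^sup>2)"
  using assms by (auto simp: sqdist_def scalar_prod_def power2_eq_square lessThan_atLeast0 intro!: sum.cong)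

lemma sqdist_nonneg: "sqdist x y \<ge> 0"
  by (auto simp: sqdist_def scalar_prod_def intro!: sum_nonneg)

lemma sqdist_pos:
  assumes "x \<in> carrier_vec d" "y \<in> carrier_vec d" "x \<noteq> y"
  shows "sqdist x y > 0"
proof -
  obtain i where i: "i < d" "vec_index x i \<noteq> vec_index y i"
    using assms by (metis carrier_vecD eq_vecI)
  have "0 < (vec_index x i - vec_index y i)\<^sup>2" using i by simp
  also have "\<dots> \<le> (\<Sum>i<d. (vec_index x i - vec_index y i)\<^sup>2)"
    using i by (intro member_le_sum) auto
  finally show ?thesis using assms by (simp add: sqdist_altdef)
qed

text \<open>In each coordinate the two sides differ by the square
  \<open>(u + v - 2 * w)\<^sup>2\<close>.\<close>

lemma sqdist_triangle2:
  assumes "x \<in> carrier_vec d" "y \<in> carrier_vec d" "c \<in> carrier_vec d"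
  shows "sqdist x y \<le> 2 * (sqdist x c + sqdist y c)"
proof -
  have "(u - v)\<^sup>2 \<le> 2 * ((u - w)\<^sup>2 + (v - w)\<^sup>2)" for u v w :: real
  proof -
    have "0 \<le> (u + v - 2 * w)\<^sup>2" by simp
    then show ?thesis by (simp add: power2_eq_square algebra_simps)
  qed
  then have "(\<Sum>i<d. (vec_index x i - vec_index y i)\<^sup>2) \<le>
      (\<Sum>i<d. 2 * ((vec_index x i - vec_index c i)\<^sup>2 + (vec_index y i - vec_index c i)\<^sup>2))"
    by (intro sum_mono) blast
  also have "\<dots> = 2 * (sqdist x c + sqdist y c)"
    using assms by (simp add: sqdist_altdef sum_distrib_left sum.distrib)
  finally show ?thesis using assms by (simp add: sqdist_altdef)
qed

lemma center_sqdist_le: "finite C \<Longrightarrow> c \<in> C \<Longrightarrow> center_sqdist C x \<le> sqdist x c"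
  by (simp add: center_sqdist_def)

lemma center_sqdist_geI:
  assumes "finite C" "C \<noteq> {}" "\<And>c. c \<in> C \<Longrightarrow> b \<le> sqdist x c"
  shows "b \<le> center_sqdist C x"
  using assms by (simp add: center_sqdist_def)

lemma center_sqdist_eqI:
  assumes "finite C" "c \<in> C" "\<And>c'. c' \<in> C \<Longrightarrow> sqdist x c \<le> sqdist x c'"
  shows "center_sqdist C x = sqdist x c"
  using assms by (auto intro!: antisym center_sqdist_le center_sqdist_geI)

lemma center_sqdist_attained:
  assumes "finite C" "C \<noteq> {}"
  obtains c where "c \<in> C" "center_sqdist C x = sqdist x c"
proof -
  have "center_sqdist C x \<in> sqdist x ` C"
    unfolding center_sqdist_def using assms by (intro Min_in) auto
  then show ?thesis using that by blast
qed

lemma kmeans_cost_nonneg: "finite C \<Longrightarrow> C \<noteq> {} \<Longrightarrow> kmeans_cost X C \<ge> 0"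
  unfolding kmeans_cost_def by (intro sum_nonneg center_sqdist_nonneg)

lemma kmeans_opt_le:
  assumes "C \<subseteq> carrier_vec d" "finite C" "card C = k" "k > 0"
  shows "kmeans_opt d k X \<le> kmeans_cost X C"
  unfolding kmeans_opt_def using assms
  by (intro cINF_lower bdd_belowI2[of _ 0] kmeans_cost_nonneg) (auto simp: card_gt_0_iff)

text \<open>Two of the points share a nearest center, which cannot be close to both.\<close>
lemma kmeans_opt_pos:
  fixes X C0 :: "real vec set"
  assumes X: "finite X" "X \<subseteq> carrier_vec d" and k: "0 < k" "k < card X"
    and ex: "C0 \<subseteq> carrier_vec d" "finite C0" "card C0 = k"
  shows "kmeans_opt d k X > 0"
proof -
  \<comment> \<open>The infimum ranges over infinitely many center sets, so positivity of each cost
    is not enough. Half the least squared distance of distinct points bounds all costs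
    uniformly.\<close>
  define D where "D = (\<lambda>(x, y). sqdist x y) ` {(x, y). x \<in> X \<and> y \<in> X \<and> x \<noteq> y}"
  have "finite {(x, y). x \<in> X \<and> y \<in> X \<and> x \<noteq> y}"
    by (rule finite_subset[of _ "X \<times> X"]) (use X in auto)
  then have fin: "finite D" unfolding D_def by simp
  have low: "Min D / 2 \<le> kmeans_cost X C \<and> 0 < Min D"
    if C: "C \<subseteq> carrier_vec d" "finite C" "card C = k" for C
  proof -
    have ne: "C \<noteq> {}" using C k by auto
    define near where "near x = (SOME c. c \<in> C \<and> center_sqdist C x = sqdist x c)" for x
    have near: "near x \<in> C" "center_sqdist C x = sqdist x (near x)" for x
    proof -
      have "\<exists>c. c \<in> C \<and> center_sqdist C x = sqdist x c"
        using center_sqdist_attained[OF C(2) ne] by metis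
      from someI_ex[OF this] show "near x \<in> C" "center_sqdist C x = sqdist x (near x)"
        by (auto simp: near_def)
    qed
    have "card (near ` X) \<le> card C" using near C by (intro card_mono) auto
    then have "card (near ` X) < card X" using k C by simp
    then have "\<not> inj_on near X" by (rule pigeonhole)
    then obtain x y where xy: "x \<in> X" "y \<in> X" "x \<noteq> y" "near x = near y"
      by (auto simp: inj_on_def)
    have D: "sqdist x y \<in> D" using xy by (force simp: D_def)
    have "Min D \<le> sqdist x y" using D fin by simp
    also have "\<dots> \<le> 2 * (sqdist x (near x) + sqdist y (near x))"
      using xy X C near by (intro sqdist_triangle2) auto
    also have "sqdist x (near x) + sqdist y (near x) = (\<Sum>z\<in>{x, y}. center_sqdist C z)"
      using xy near by simp
    also have "\<dots> \<le> kmeans_cost X C"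
      unfolding kmeans_cost_def
      by (rule sum_mono2) (use X xy center_sqdist_nonneg[OF C(2) ne] in auto)
    finally have "Min D / 2 \<le> kmeans_cost X C" by simp
    \<comment> \<open>The colliding pair also shows that \<open>D\<close> is nonempty, so
      \<open>Min D\<close> is meaningful.\<close>
    moreover have "0 < Min D"
    proof -
      have "z > 0" if "z \<in> D" for z using that X by (auto simp: D_def intro!: sqdist_pos[of _ d])
      then show ?thesis using D fin by (subst Min_gr_iff) auto
    qed
    ultimately show ?thesis by simp
  qed
  have "Min D / 2 \<le> kmeans_opt d k X"
    unfolding kmeans_opt_def
  proof (rule cINF_greatest)
    show "{C :: real vec set. C \<subseteq> carrier_vec d \<and> finite C \<and> card C = k} \<noteq> {}"
      using ex by blast
  qed (use low in blast)
  then show ?thesis using low[OF ex] by linarith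
qed

section \<open>Iterated sampling\<close>

text \<open>The algorithm is defined by appending steps at the end; this form conditions on the
  starting state instead.\<close>

lemma funpow_bind_pmf:
  fixes f :: "'a \<Rightarrow> 'a pmf"
  shows "((\<lambda>P. bind_pmf P f) ^^ n) M = bind_pmf M (\<lambda>x. ((\<lambda>P. bind_pmf P f) ^^ n) (return_pmf x))"
proof (induction n arbitrary: M)
  case 0
  then show ?case by (simp add: bind_return_pmf')
next
  case (Suc n)
  have "((\<lambda>P. bind_pmf P f) ^^ Suc n) M =
      bind_pmf (((\<lambda>P. bind_pmf P f) ^^ n) M) f" by simp
  also have "\<dots> = bind_pmf M (\<lambda>x. bind_pmf (((\<lambda>P. bind_pmf P f) ^^ n) (return_pmf x)) f)"
    by (subst Suc) (simp add: bind_assoc_pmf)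
  finally show ?case by simp
qed

definition greedy_iter :: "nat \<Rightarrow> real vec set \<Rightarrow> nat \<Rightarrow> real vec set \<Rightarrow> real vec set pmf" where
  "greedy_iter l X n C = ((\<lambda>P. bind_pmf P (greedy_step l X)) ^^ n) (return_pmf C)"

lemma greedy_iter_0: "greedy_iter l X 0 C = return_pmf C"
  by (simp add: greedy_iter_def)

text \<open>Peeling off the first step rather than the last lets an induction on \<open>n\<close>
  vary the current center set.\<close>

lemma greedy_iter_Suc:
  "greedy_iter l X (Suc n) C = bind_pmf (greedy_step l X C) (greedy_iter l X n)"
proof -
  have "greedy_iter l X (Suc n) C =
      ((\<lambda>P. bind_pmf P (greedy_step l X)) ^^ n) (greedy_step l X C)"
    by (simp add: greedy_iter_def funpow_Suc_right bind_return_pmf del: funpow.simps)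
  also have "\<dots> = bind_pmf (greedy_step l X C) (greedy_iter l X n)"
    by (subst funpow_bind_pmf) (simp add: greedy_iter_def cong: bind_pmf_cong)
  finally show ?thesis .
qed

lemma greedy_kmeanspp_eq:
  "greedy_kmeanspp k l X =
    bind_pmf (pmf_of_set X) (\<lambda>c. greedy_iter l X (k - 1) {c})"
  unfolding greedy_kmeanspp_def
  by (subst funpow_bind_pmf) (simp add: greedy_iter_def map_pmf_def bind_assoc_pmf bind_return_pmf)

lemma measure_bind_pmf_eq:
  "measure_pmf.prob (bind_pmf M f) A = measure_pmf.expectation M (\<lambda>x. measure_pmf.prob (f x) A)"
  by (simp add: measure_pmf_bind)
    (subst measure_pmf.measure_bind[where N = "count_space UNIV"],
      auto simp: space_subprob_algebra
        intro!: prob_space_imp_subprob_space measure_pmf.prob_space_axioms)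

lemma integrable_prob: "integrable (measure_pmf M) (\<lambda>x. measure_pmf.prob (f x) A)"
  by (rule measure_pmf.integrable_const_bound[where B = 1]) auto

lemma integrable_indicator_scaled:
  fixes b :: real
  shows "integrable (measure_pmf M) (\<lambda>x. b * indicator G x)"
  by (rule measure_pmf.integrable_const_bound[where B = "\<bar>b\<bar>"]) (auto simp: indicator_def)

text \<open>\<open>G\<close> collects the intermediate outcomes after which \<open>A\<close> is
  still possible; bounds for successive steps then multiply.\<close>

lemma prob_bind_pmf_le:
  assumes "\<And>x. x \<in> set_pmf M \<Longrightarrow> x \<in> G \<Longrightarrow> measure_pmf.prob (f x) A \<le> b"
    and "\<And>x. x \<in> set_pmf M \<Longrightarrow> x \<notin> G \<Longrightarrow> measure_pmf.prob (f x) A = 0"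
  shows "measure_pmf.prob (bind_pmf M f) A \<le> b * measure_pmf.prob M G"
proof -
  have "measure_pmf.prob (bind_pmf M f) A \<le> measure_pmf.expectation M (\<lambda>x. b * indicator G x)"
    unfolding measure_bind_pmf_eq
    by (rule integral_mono_AE[OF integrable_prob integrable_indicator_scaled])
      (use assms in \<open>auto simp: AE_measure_pmf_iff indicator_def\<close>)
  then show ?thesis by simp
qed

lemma prob_bind_pmf_ge:
  assumes "\<And>x. x \<in> G \<Longrightarrow> b \<le> measure_pmf.prob (f x) A"
  shows "b * measure_pmf.prob M G \<le> measure_pmf.prob (bind_pmf M f) A"
proof -
  have "measure_pmf.expectation M (\<lambda>x. b * indicator G x) \<le> measure_pmf.prob (bind_pmf M f) A"
    unfolding measure_bind_pmf_eq
    by (rule integral_mono_AE[OF integrable_indicator_scaled integrable_prob])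
      (use assms in \<open>auto simp: AE_measure_pmf_iff indicator_def\<close>)
  then show ?thesis by simp
qed

lemma prob_replicate_pmf_avoid:
  "measure_pmf.prob (replicate_pmf n p) {us. x \<notin> set us} \<le> (1 - pmf p x) ^ n"
proof (induction n)
  case 0
  then show ?case by simp
next
  case (Suc n)
  have "measure_pmf.prob (replicate_pmf (Suc n) p) {us. x \<notin> set us} =
      measure_pmf.prob (bind_pmf p (\<lambda>u. map_pmf ((#) u) (replicate_pmf n p))) {us. x \<notin> set us}"
    by (simp add: map_pmf_def)
  also have "\<dots> \<le> (1 - pmf p x) ^ n * measure_pmf.prob p (- {x})"
  proof (rule prob_bind_pmf_le)
    fix u assume "u \<in> - {x}"
    then show "measure_pmf.prob (map_pmf ((#) u) (replicate_pmf n p)) {us. x \<notin> set us} \<le>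
        (1 - pmf p x) ^ n" using Suc by (auto simp: vimage_def)
  next
    fix u assume "u \<notin> - {x}"
    then show "measure_pmf.prob (map_pmf ((#) u) (replicate_pmf n p)) {us. x \<notin> set us} = 0"
      by (auto simp: vimage_def)
  qed
  also have "measure_pmf.prob p (- {x}) = 1 - pmf p x"
    using measure_pmf.prob_compl[of "{x}" p] by (simp add: Compl_eq_Diff_UNIV measure_pmf_single)
  finally show ?case by (simp add: mult.commute)
qed

lemma set_pmf_D2_sampling:
  assumes "finite X" "X \<noteq> {}" "finite C" "C \<noteq> {}"
  shows "set_pmf (D2_sampling X C) \<subseteq> X"
proof (cases "kmeans_cost X C = 0")
  case True
  then show ?thesis using assms by (simp add: D2_sampling_def)
next
  case False
  then show ?thesis using pmf_D2_sampling[OF assms(1,3,4) False]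
    by (auto simp: set_pmf_eq split: if_splits)
qed

lemma set_pmf_greedy_step:
  assumes "finite X" "X \<noteq> {}" "finite C" "C \<noteq> {}" "l \<ge> 1" "C' \<in> set_pmf (greedy_step l X C)"
  obtains u where "u \<in> X" "C' = insert u C"
proof -
  obtain us where us: "us \<in> set_pmf (replicate_pmf l (D2_sampling X C))"
    "C' = insert (arg_min_on (\<lambda>u. kmeans_cost X (insert u C)) (set us)) C"
    using assms(6) by (auto simp: greedy_step_def)
  \<comment> \<open>Here \<open>l \<ge> 1\<close> matters: \<open>arg_min_on\<close> picks an
    element of the sample only if the sample is nonempty.\<close>
  then have "set us \<subseteq> X" "set us \<noteq> {}"
    using set_pmf_D2_sampling[OF assms(1-4)] assms(5) by (auto simp: set_replicate_pmf)
  then show ?thesis using that us(2) arg_min_if_finite(1)[of "set us"] by blast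
qed

text \<open>Each step adds at most one center. The bound on \<open>card (C' - C)\<close> later turns
  a step without a new apex into certain failure.\<close>

lemma set_pmf_greedy_iter:
  assumes "finite X" "X \<noteq> {}" "C \<subseteq> X" "C \<noteq> {}" "l \<ge> 1" "C' \<in> set_pmf (greedy_iter l X n C)"
  shows "C' \<subseteq> X \<and> C' \<noteq> {} \<and> C \<subseteq> C' \<and> card (C' - C) \<le> n"
  using assms(3,4,6)
proof (induction n arbitrary: C)
  case 0
  then show ?case by (simp add: greedy_iter_0)
next
  case (Suc n)
  have fin: "finite C" using Suc.prems assms(1) finite_subset by blast
  obtain C1 where C1: "C1 \<in> set_pmf (greedy_step l X C)" "C' \<in> set_pmf (greedy_iter l X n C1)"
    using Suc.prems by (auto simp: greedy_iter_Suc)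
  obtain u where u: "u \<in> X" "C1 = insert u C"
    using set_pmf_greedy_step[OF assms(1,2) fin Suc.prems(2) assms(5) C1(1)] .
  have IH: "C' \<subseteq> X \<and> C' \<noteq> {} \<and> C1 \<subseteq> C' \<and> card (C' - C1) \<le> n"
    using Suc.IH[OF _ _ C1(2)] u Suc.prems by auto
  then have finC': "finite C'" using assms(1) finite_subset by blast
  have "card (C' - C) \<le> card (insert u (C' - C1))"
    using finC' u by (intro card_mono) auto
  also have "\<dots> \<le> Suc n" using IH finC' by (simp add: card_insert_if)
  finally show ?case using IH u by auto
qed

section \<open>The hard instance\<close>

lemma one_minus_exp_ge:
  fixes x :: real
  assumes "x \<ge> 0"
  shows "x / (1 + x) \<le> 1 - exp (- x)"
proof -
  have "inverse (exp x) \<le> inverse (1 + x)"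
    using assms exp_ge_add_one_self[of x] by (intro le_imp_inverse_le) auto
  moreover have "x / (1 + x) = 1 - inverse (1 + x)"
    using assms by (simp add: field_simps)
  ultimately show ?thesis by (simp add: exp_minus)
qed

text \<open>The logarithms telescope, and each increment \<open>ln (1 + 1 / n)\<close> is at most
  \<open>1 / n\<close>.\<close>

lemma harmonic_segment_ge:
  assumes "1 \<le> M" "M \<le> n"
  shows "ln (real n) - ln (real M) \<le> (\<Sum>m = M..<n. 1 / real m)"
  using assms(2)
proof (induction n rule: dec_induct)
  case base
  then show ?case by simp
next
  case (step n)
  have n: "0 < real n" using step assms by simp
  then have "1 + 1 / real n = real (Suc n) / real n" by (simp add: field_simps)
  then have "ln (real (Suc n)) - ln (real n) = ln (1 + 1 / real n)"
    using n by (simp add: ln_div)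
  also have "\<dots> \<le> 1 / real n" by (rule ln_add_one_self_le_self) simp
  finally show ?case using step by simp
qed

section \<open>The point set and its distances\<close>

locale hard_instance =
  fixes k :: nat and a :: real
  assumes k_ge: "k \<ge> 4" and a_ge: "a \<ge> 1"
begin

definition axis_point :: "real \<Rightarrow> real vec" where
  "axis_point s = vec k (\<lambda>j. if j = k - 1 then s else 0)"

text \<open>All apexes share the last coordinate, of index \<open>k - 1\<close>, so a center moved
  along that axis from 0 towards \<open>a\<close> approaches all of them at once. The private
  coordinate \<open>i\<close> keeps them apart from each other.\<close>

definition apex :: "nat \<Rightarrow> real vec" where
  "apex i = vec k (\<lambda>j. if j = k - 1 \<or> j = i then a else 0)"

text \<open>The cluster near the origin: \<open>k\<close> distinct points, since the input is a set and not a multiset.\<close>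
definition offsets :: "real set" where
  "offsets = (\<lambda>j. real j / (16 * real k ^ 2)) ` {..<k}"

definition apexes :: "real vec set" where "apexes = apex ` {..<k - 1}"

definition points :: "real vec set" where
  "points = insert (axis_point 1) (axis_point ` offsets \<union> apexes)"

lemma carrier: "axis_point s \<in> carrier_vec k" "apex i \<in> carrier_vec k"
  by (auto simp: axis_point_def apex_def)

lemma sqdist_sym: "x \<in> carrier_vec k \<Longrightarrow> y \<in> carrier_vec k \<Longrightarrow> sqdist x y = sqdist y x"
  by (simp add: sqdist_altdef power2_commute)

lemma sqdist_axis_axis: "sqdist (axis_point s) (axis_point t) = (s - t)\<^sup>2"
proof -
  have "sqdist (axis_point s) (axis_point t) = (\<Sum>i<k. if i = k - 1 then (s - t)\<^sup>2 else 0)"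
    unfolding sqdist_altdef[OF carrier(1) carrier(1)]
    by (intro sum.cong) (auto simp: axis_point_def)
  then show ?thesis using k_ge by simp
qed

lemma sqdist_apex_axis:
  assumes "i < k - 1" shows "sqdist (apex i) (axis_point s) = (a - s)\<^sup>2 + a\<^sup>2"
proof -
  have "sqdist (apex i) (axis_point s) =
      (\<Sum>j<k. (if j = k - 1 then (a - s)\<^sup>2 else 0) + (if j = i then a\<^sup>2 else 0))"
    unfolding sqdist_altdef[OF carrier(2) carrier(1)] using assms
    by (intro sum.cong) (auto simp: axis_point_def apex_def)
  then show ?thesis using k_ge assms by (simp add: sum.distrib)
qed

lemma sqdist_apex_apex:
  assumes "i < k - 1" "j < k - 1" "i \<noteq> j" shows "sqdist (apex i) (apex j) = 2 * a\<^sup>2"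
proof -
  have "sqdist (apex i) (apex j) =
      (\<Sum>n<k. (if n = i then a\<^sup>2 else 0) + (if n = j then a\<^sup>2 else 0))"
    unfolding sqdist_altdef[OF carrier(2) carrier(2)] using assms
    by (intro sum.cong) (auto simp: apex_def)
  moreover have "i < k" "j < k" using assms by auto
  ultimately show ?thesis by (simp add: sum.distrib)
qed

lemma sqdist_self: "x \<in> carrier_vec k \<Longrightarrow> sqdist x x = 0"
  by (simp add: sqdist_altdef)

lemma sqdist_axis_apex:
  "i < k - 1 \<Longrightarrow> sqdist (axis_point s) (apex i) = (a - s)\<^sup>2 + a\<^sup>2"
  using sqdist_apex_axis sqdist_sym carrier by metis

lemma apex_sqdists:
  assumes "p \<in> apexes"
  shows "sqdist p (axis_point s) = (a - s)\<^sup>2 + a\<^sup>2" "sqdist (axis_point s) p = (a - s)\<^sup>2 + a\<^sup>2"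
    and "sqdist p p = 0" and "p' \<in> apexes \<Longrightarrow> p \<noteq> p' \<Longrightarrow> sqdist p p' = 2 * a\<^sup>2"
proof -
  obtain i where i: "i < k - 1" "p = apex i" using assms by (auto simp: apexes_def)
  show "sqdist p (axis_point s) = (a - s)\<^sup>2 + a\<^sup>2" "sqdist (axis_point s) p = (a - s)\<^sup>2 + a\<^sup>2"
    "sqdist p p = 0"
    using i sqdist_apex_axis sqdist_axis_apex sqdist_self carrier by auto
  assume "p' \<in> apexes" "p \<noteq> p'"
  then obtain j where "j < k - 1" "p' = apex j" "i \<noteq> j" using i by (auto simp: apexes_def)
  then show "sqdist p p' = 2 * a\<^sup>2" using i sqdist_apex_apex by simp
qed

lemma axis_point_inj: "axis_point s = axis_point t \<longleftrightarrow> s = t"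
  using sqdist_axis_axis[of s t] sqdist_self[OF carrier(1), of t] by auto

lemma axis_point_not_apex: "axis_point s \<notin> apexes"
proof
  assume "axis_point s \<in> apexes"
  then have "(a - s)\<^sup>2 + a\<^sup>2 = 0"
    using apex_sqdists(1,3)[of "axis_point s"] by metis
  then show False using a_ge by (simp add: sum_power2_eq_zero_iff)
qed

text \<open>The bound by \<open>1 / (16 * real k)\<close> keeps the cost of the whole cluster below
  a constant; \<open>1 / 64\<close> enters the numerical comparisons of a cluster center with the
  tip.\<close>

lemma offsets: assumes "s \<in> offsets" shows "0 \<le> s" "s \<le> 1 / (16 * real k)" "s \<le> 1 / 64"
proof -
  obtain j where j: "j < k" "s = real j / (16 * real k ^ 2)"
    using assms by (auto simp: offsets_def)
  show "0 \<le> s" using j by simp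
  have "s \<le> real k / (16 * real k ^ 2)" unfolding j(2) using j by (intro divide_right_mono) auto
  also have "\<dots> = 1 / (16 * real k)" using k_ge by (simp add: power2_eq_square)
  finally show le: "s \<le> 1 / (16 * real k)" .
  have "1 / (16 * real k) \<le> 1 / 64" using k_ge by (simp add: field_simps)
  with le show "s \<le> 1 / 64" by linarith
qed

lemma card_offsets: "finite offsets" "card offsets = k"
proof -
  have "inj_on (\<lambda>j. real j / (16 * real k ^ 2)) {..<k}" using k_ge by (auto simp: inj_on_def)
  then show "card offsets = k" by (simp add: offsets_def card_image)
qed (simp add: offsets_def)

lemma card_apexes: "finite apexes" "card apexes = k - 1"
proof -
  have "inj_on apex {..<k - 1}"
  proof (rule inj_onI, rule ccontr)
    fix i j assume *: "i \<in> {..<k - 1}" "j \<in> {..<k - 1}" "apex i = apex j" "i \<noteq> j"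
    then show False using sqdist_apex_apex[of i j] sqdist_self[OF carrier(2), of j] a_ge by simp
  qed
  then show "card apexes = k - 1" by (simp add: apexes_def card_image)
qed (simp add: apexes_def)

lemma points: "finite points" "points \<noteq> {}" "points \<subseteq> carrier_vec k"
  using card_offsets card_apexes carrier by (auto simp: points_def apexes_def)

lemma sum_points:
  "sum f points = (\<Sum>t\<in>offsets. f (axis_point t)) + f (axis_point 1) + sum f apexes"
proof -
  have "axis_point 1 \<notin> axis_point ` offsets \<union> apexes"
    using offsets(3)[of 1] axis_point_not_apex by (auto simp: axis_point_inj)
  then have "sum f points = f (axis_point 1) + sum f (axis_point ` offsets \<union> apexes)"
    using card_offsets card_apexes by (simp add: points_def)
  also have "sum f (axis_point ` offsets \<union> apexes) = sum f (axis_point ` offsets) + sum f apexes"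
    using card_offsets card_apexes axis_point_not_apex by (intro sum.union_disjoint) auto
  also have "sum f (axis_point ` offsets) = (\<Sum>t\<in>offsets. f (axis_point t))"
    by (subst sum.reindex) (auto simp: inj_on_def axis_point_inj)
  finally show ?thesis by (simp add: ac_simps)
qed

lemma card_points: "card points = 2 * k"
  using sum_points[of "\<lambda>_. 1 :: nat"] card_offsets card_apexes k_ge by simp

section \<open>Costs of one axis point together with some apexes\<close>

lemma offsets_cost_le:
  assumes "s \<in> offsets" shows "(\<Sum>t\<in>offsets. (t - s)\<^sup>2) \<le> 1"
proof -
  have "(t - s)\<^sup>2 \<le> 1 / real k" if "t \<in> offsets" for t
  proof -
    have "\<bar>t - s\<bar> \<le> 1 / (16 * real k)" using offsets[OF that] offsets[OF assms] by linarith
    also have "\<dots> \<le> 1 / real k" using k_ge by (simp add: field_simps)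
    finally have 1: "\<bar>t - s\<bar> \<le> 1 / real k" .
    then have "\<bar>t - s\<bar> * \<bar>t - s\<bar> \<le> 1 / real k * 1"
      using k_ge offsets[OF that] offsets[OF assms] by (intro mult_mono) auto
    then show ?thesis by (simp add: power2_eq_square)
  qed
  then have "(\<Sum>t\<in>offsets. (t - s)\<^sup>2) \<le> (\<Sum>t\<in>offsets. 1 / real k)" by (rule sum_mono)
  then show ?thesis using card_offsets k_ge by simp
qed

text \<open>Another apex is at squared distance \<open>2 * a\<^sup>2\<close>, which is no closer
  than the axis point since \<open>0 \<le> s \<le> 1 \<le> a\<close>. Thus chosen apexes never help
  missing ones.\<close>

lemma center_sqdist_apex:
  assumes "V \<subseteq> apexes" "0 \<le> s" "s \<le> 1" "p \<in> apexes"
  shows "center_sqdist (insert (axis_point s) V) p = (if p \<in> V then 0 else (a - s)\<^sup>2 + a\<^sup>2)"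
proof -
  have fin: "finite V" using assms card_apexes finite_subset by blast
  have le: "(a - s)\<^sup>2 \<le> a\<^sup>2" using assms a_ge by (intro power_mono) auto
  show ?thesis
  proof (cases "p \<in> V")
    case True
    then have "center_sqdist (insert (axis_point s) V) p = sqdist p p"
      using fin assms apex_sqdists sqdist_nonneg by (intro center_sqdist_eqI) auto
    then show ?thesis using True apex_sqdists assms by simp
  next
    case False
    have "center_sqdist (insert (axis_point s) V) p = sqdist p (axis_point s)"
    proof (rule center_sqdist_eqI)
      fix c assume "c \<in> insert (axis_point s) V"
      then consider "c = axis_point s" | "c \<in> apexes" "p \<noteq> c" using assms False by auto
      then show "sqdist p (axis_point s) \<le> sqdist p c"
        by cases (use apex_sqdists assms le in auto)
    qed (use fin in auto)
    then show ?thesis using False apex_sqdists assms by simp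
  qed
qed

text \<open>Every apex is at squared distance at least \<open>a\<^sup>2\<close> from the axis, hence
  no closer than \<open>axis_point s\<close>.\<close>

lemma center_sqdist_axis:
  assumes "V \<subseteq> apexes" "0 \<le> s" "s \<le> 1" "0 \<le> t" "t \<le> 1"
  shows "center_sqdist (insert (axis_point s) V) (axis_point t) = (t - s)\<^sup>2"
proof -
  have fin: "finite V" using assms card_apexes finite_subset by blast
  have "\<bar>t - s\<bar> \<le> \<bar>a\<bar>" using assms a_ge by linarith
  then have le: "(t - s)\<^sup>2 \<le> a\<^sup>2" by (simp add: abs_le_square_iff)
  have "center_sqdist (insert (axis_point s) V) (axis_point t) = sqdist (axis_point t) (axis_point s)"
  proof (rule center_sqdist_eqI)
    fix c assume "c \<in> insert (axis_point s) V"
    then consider "c = axis_point s" | "c \<in> apexes" using assms by auto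
    then show "sqdist (axis_point t) (axis_point s) \<le> sqdist (axis_point t) c"
    proof cases
      case 2
      have "(0::real) \<le> (a - t)\<^sup>2" by simp
      then show ?thesis using le 2 by (simp only: apex_sqdists sqdist_axis_axis)
    qed simp
  qed (use fin in auto)
  then show ?thesis by (simp add: sqdist_axis_axis)
qed

lemma cost_eq:
  assumes "V \<subseteq> apexes" "0 \<le> s" "s \<le> 1"
  shows "kmeans_cost points (insert (axis_point s) V) =
    (\<Sum>t\<in>offsets. (t - s)\<^sup>2) + (1 - s)\<^sup>2 + real (card (apexes - V)) * ((a - s)\<^sup>2 + a\<^sup>2)"
proof -
  have "(\<Sum>t\<in>offsets. center_sqdist (insert (axis_point s) V) (axis_point t)) =
      (\<Sum>t\<in>offsets. (t - s)\<^sup>2)"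
    using assms by (intro sum.cong center_sqdist_axis) (auto dest: offsets)
  moreover have "(\<Sum>p\<in>apexes. center_sqdist (insert (axis_point s) V) p) =
      (\<Sum>p\<in>apexes - V. (a - s)\<^sup>2 + a\<^sup>2)"
    using assms card_apexes
    by (intro sum.mono_neutral_cong_right) (auto simp: center_sqdist_apex)
  ultimately show ?thesis
    using assms by (simp add: kmeans_cost_def sum_points center_sqdist_axis)
qed

section \<open>The tip against a missing apex in one greedy step\<close>

lemma cost_insert_tip_le:
  assumes "V \<subseteq> apexes" "s \<in> offsets"
  shows "kmeans_cost points (insert (axis_point 1) (insert (axis_point s) V)) \<le>
    (\<Sum>t\<in>offsets. (t - s)\<^sup>2) + real (card (apexes - V)) * ((a - 1)\<^sup>2 + a\<^sup>2)"
proof -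
  let ?C = "insert (axis_point 1) (insert (axis_point s) V)"
  have fin: "finite ?C" using assms card_apexes finite_subset by auto
  have "(\<Sum>t\<in>offsets. center_sqdist ?C (axis_point t)) \<le> (\<Sum>t\<in>offsets. (t - s)\<^sup>2)"
  proof (rule sum_mono)
    fix t
    show "center_sqdist ?C (axis_point t) \<le> (t - s)\<^sup>2"
      using center_sqdist_le[OF fin, of "axis_point s" "axis_point t"] by (simp add: sqdist_axis_axis)
  qed
  moreover have "center_sqdist ?C (axis_point 1) \<le> 0"
    using center_sqdist_le[OF fin, of "axis_point 1" "axis_point 1"] by (simp add: sqdist_axis_axis)
  \<comment> \<open>A fixed assignment suffices for an upper bound: a chosen apex serves itself, the
    tip serves the missing ones.\<close>
  moreover have "(\<Sum>p\<in>apexes. center_sqdist ?C p) \<le>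
      (\<Sum>p\<in>apexes. if p \<in> apexes - V then (a - 1)\<^sup>2 + a\<^sup>2 else 0)"
  proof (rule sum_mono)
    fix p assume p: "p \<in> apexes"
    show "center_sqdist ?C p \<le> (if p \<in> apexes - V then (a - 1)\<^sup>2 + a\<^sup>2 else 0)"
      using p center_sqdist_le[OF fin, of p p] center_sqdist_le[OF fin, of "axis_point 1" p]
        apex_sqdists[OF p] by auto
  qed
  moreover have "(\<Sum>p\<in>apexes. if p \<in> apexes - V then (a - 1)\<^sup>2 + a\<^sup>2 else 0) =
      real (card (apexes - V)) * ((a - 1)\<^sup>2 + a\<^sup>2)"
    using card_apexes by (subst sum.inter_restrict[symmetric]) (auto simp: Int_absorb1)
  ultimately show ?thesis unfolding kmeans_cost_def sum_points by linarith
qed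

text \<open>Adding \<open>p\<close> saves \<open>(a - s)\<^sup>2 + a\<^sup>2\<close>, at most
  \<open>2 * a\<^sup>2\<close>. Adding the tip saves at least
  \<open>(a - s)\<^sup>2 - (a - 1)\<^sup>2\<close>, of order \<open>a\<close>, for every missing
  apex, so order \<open>a\<close> missing apexes are enough.\<close>

lemma tip_beats_apex:
  assumes V: "V \<subseteq> apexes" and s: "s \<in> offsets" and p: "p \<in> apexes - V"
    and r: "3 * a \<le> real (card (apexes - V))"
  shows "kmeans_cost points (insert (axis_point 1) (insert (axis_point s) V)) <
    kmeans_cost points (insert p (insert (axis_point s) V))"
proof -
  let ?r = "real (card (apexes - V))"
  have s': "0 \<le> s" "s \<le> 1 / 64" using offsets[OF s] by auto
  have fin: "finite (apexes - V)" using card_apexes by simp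
  have "apexes - insert p V = (apexes - V) - {p}" by auto
  then have "real (card (apexes - insert p V)) = ?r - 1"
    using p r a_ge by (simp add: of_nat_diff)
  then have eq: "kmeans_cost points (insert p (insert (axis_point s) V)) =
      (\<Sum>t\<in>offsets. (t - s)\<^sup>2) + (1 - s)\<^sup>2 + (?r - 1) * ((a - s)\<^sup>2 + a\<^sup>2)"
    using cost_eq[of "insert p V" s] V p s' by (simp add: insert_commute)
  have sq: "(a - s)\<^sup>2 \<le> a\<^sup>2" using s' a_ge by (intro power_mono) auto
  \<comment> \<open>As \<open>s\<close> is at most 1/64, the saving per missing apex is at least
    \<open>3 / 4 * a\<close>. With \<open>3 * a\<close> missing apexes this totals
    \<open>9 / 4 * a\<^sup>2\<close>, just above \<open>2 * a\<^sup>2\<close>; hence the threshold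
    \<open>3 * a\<close>.\<close>
  have "a * (3 / 4 * a) \<le> a * ((63 / 64) * (2 * a - 65 / 64))"
    using a_ge by (intro mult_left_mono) auto
  then have "2 * a\<^sup>2 < (3 * a) * ((63 / 64) * (2 * a - 65 / 64))"
    using a_ge mult_pos_pos[of a a] by (simp add: power2_eq_square)
  also have "\<dots> \<le> ?r * ((1 - s) * (2 * a - 1 - s))"
    using r s' a_ge by (intro mult_mono) auto
  also have "(1 - s) * (2 * a - 1 - s) = (a - s)\<^sup>2 - (a - 1)\<^sup>2"
    by (simp add: power2_eq_square algebra_simps)
  finally have gain: "2 * a\<^sup>2 < ?r * ((a - s)\<^sup>2 - (a - 1)\<^sup>2)" .
  have nonneg: "(0::real) \<le> (1 - s)\<^sup>2" by simp
  have "?r * ((a - 1)\<^sup>2 + a\<^sup>2) < (1 - s)\<^sup>2 + (?r - 1) * ((a - s)\<^sup>2 + a\<^sup>2)"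
  proof -
    \<comment> \<open>Here \<open>A\<close>, \<open>B\<close>, \<open>D\<close>, \<open>n\<close>
      stand for \<open>(a - s)\<^sup>2\<close>, \<open>a\<^sup>2\<close>,
      \<open>(a - 1)\<^sup>2\<close>, \<open>(1 - s)\<^sup>2\<close>; the claim is linear in them
      and in \<open>r * (A - D)\<close>.\<close>
    have "r * (D + B) < n + (r - 1) * (A + B)"
      if "2 * B < r * (A - D)" "A \<le> B" "0 \<le> n" for r A B D n :: real
    proof -
      have "n + (r - 1) * (A + B) - r * (D + B) = n + r * (A - D) - A - B"
        by (simp add: algebra_simps)
      then show ?thesis using that by linarith
    qed
    from this[OF gain sq nonneg] show ?thesis .
  qed
  then show ?thesis using cost_insert_tip_le[OF V s] eq by linarith
qed

text \<open>The tip contributes at least 1/2 to the cost. Cluster and tip together cost at most 2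
  and the \<open>r\<close> missing apexes at most \<open>2 * a\<^sup>2 * r\<close>, so the total is
  at most \<open>4 * a\<^sup>2 * r\<close>.\<close>

lemma pmf_tip_ge:
  assumes V: "V \<subseteq> apexes" and s: "s \<in> offsets" and r: "1 \<le> card (apexes - V)"
  shows "1 / (8 * a\<^sup>2 * real (card (apexes - V))) \<le>
    pmf (D2_sampling points (insert (axis_point s) V)) (axis_point 1)"
proof -
  let ?r = "real (card (apexes - V))" and ?C = "insert (axis_point s) V"
  have s': "0 \<le> s" "s \<le> 1 / 64" using offsets[OF s] by auto
  have fin: "finite ?C" using V card_apexes finite_subset by auto
  have sq: "(a - s)\<^sup>2 \<le> a\<^sup>2" using s' a_ge by (intro power_mono) auto
  have one: "1 \<le> a\<^sup>2" using a_ge by simp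
  have r1: "1 \<le> ?r" using r by simp
  have ar: "1 \<le> a\<^sup>2 * ?r" using mult_mono[OF one r1] by simp
  have "(63/64)\<^sup>2 \<le> (1 - s)\<^sup>2" using s' by (intro power_mono) auto
  then have half: "1 / 2 \<le> (1 - s)\<^sup>2" by (simp add: power2_eq_square)
  have "(1 - s)\<^sup>2 \<le> 1\<^sup>2" using s' by (intro power_mono) auto
  then have le1: "(1 - s)\<^sup>2 \<le> 1" by simp
  have cost: "kmeans_cost points ?C =
      (\<Sum>t\<in>offsets. (t - s)\<^sup>2) + (1 - s)\<^sup>2 + ?r * ((a - s)\<^sup>2 + a\<^sup>2)"
    using cost_eq V s' by simp
  have "?r * ((a - s)\<^sup>2 + a\<^sup>2) \<le> ?r * (2 * a\<^sup>2)" using sq by (intro mult_left_mono) auto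
  then have up: "kmeans_cost points ?C \<le> 4 * (a\<^sup>2 * ?r)"
    using cost le1 offsets_cost_le[OF s] ar mult.left_commute[of ?r 2 "a\<^sup>2"] mult.commute[of ?r "a\<^sup>2"]
    by linarith
  have "0 \<le> (\<Sum>t\<in>offsets. (t - s)\<^sup>2)" "0 \<le> ?r * ((a - s)\<^sup>2 + a\<^sup>2)" by (auto intro: sum_nonneg)
  then have pos: "kmeans_cost points ?C > 0" using cost half by linarith
  have "pmf (D2_sampling points ?C) (axis_point 1) = (1 - s)\<^sup>2 / kmeans_cost points ?C"
    using pmf_D2_sampling[OF points(1) fin] pos V s'
    by (auto simp: points_def center_sqdist_axis)
  moreover have "(1 / 2) / (4 * (a\<^sup>2 * ?r)) \<le> (1 - s)\<^sup>2 / kmeans_cost points ?C"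
    using half pos up by (intro frac_le) auto
  ultimately show ?thesis by (simp add: mult.assoc)
qed

section \<open>The probability of finding all apexes\<close>

text \<open>Exponent of the probability that all \<open>r\<close> missing apexes are found in \<open>r\<close> steps.\<close>
definition hazard :: "nat \<Rightarrow> nat \<Rightarrow> real" where
  "hazard l r = real l / (8 * a\<^sup>2) * (\<Sum>m | 3 * a \<le> real m \<and> m \<le> r. 1 / real m)"

lemma hazard_Suc:
  "hazard l (Suc r) =
    (if 3 * a \<le> real (Suc r) then real l / (8 * a\<^sup>2 * real (Suc r)) else 0) + hazard l r"
proof (cases "3 * a \<le> real (Suc r)")
  case True
  then have "{m. 3 * a \<le> real m \<and> m \<le> Suc r} = insert (Suc r) {m. 3 * a \<le> real m \<and> m \<le> r}"
    by (auto simp: le_Suc_eq)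
  then show ?thesis using True by (simp add: hazard_def algebra_simps add_divide_distrib)
next
  case False
  then have "{m. 3 * a \<le> real m \<and> m \<le> Suc r} = {m. 3 * a \<le> real m \<and> m \<le> r}"
    by (auto simp: le_Suc_eq)
  then show ?thesis using False by (simp add: hazard_def)
qed

text \<open>A missing apex can win only if all \<open>l\<close> samples avoid the tip, which has
  probability at most \<open>(1 - p) ^ l\<close> and hence \<open>exp (- l * p)\<close> for the tip
  probability \<open>p\<close>.\<close>

lemma prob_choose_apex_le:
  assumes V: "V \<subseteq> apexes" and s: "s \<in> offsets" and l: "l \<ge> 1"
    and r: "3 * a \<le> real (card (apexes - V))"
  shows "measure_pmf.prob (greedy_step l points (insert (axis_point s) V))
      {insert p (insert (axis_point s) V) |p. p \<in> apexes - V} \<le>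
    exp (- (real l / (8 * a\<^sup>2 * real (card (apexes - V)))))"
proof -
  let ?C = "insert (axis_point s) V" and ?r = "real (card (apexes - V))"
  let ?f = "\<lambda>u. kmeans_cost points (insert u ?C)"
  let ?D = "D2_sampling points ?C"
  let ?p = "pmf ?D (axis_point 1)"
  have r1: "1 \<le> card (apexes - V)" using r a_ge by linarith
  have "measure_pmf.prob (greedy_step l points ?C) {insert p ?C |p. p \<in> apexes - V} \<le>
      measure_pmf.prob (replicate_pmf l ?D) {us. axis_point 1 \<notin> set us}"
    unfolding greedy_step_def measure_map_pmf
  proof (rule measure_pmf.finite_measure_mono, safe)
    fix us p
    assume eq: "insert (arg_min_on ?f (set us)) ?C = insert p ?C" "p \<in> apexes" "p \<notin> V"
      and tip: "axis_point 1 \<in> set us"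
    \<comment> \<open>Since \<open>p\<close> is not yet a center, equality of the enlarged center
      sets forces the selected point to be \<open>p\<close>.\<close>
    have "p \<noteq> axis_point s" using eq(2) axis_point_not_apex by blast
    moreover have "p \<in> insert (arg_min_on ?f (set us)) ?C" by (simp only: eq(1) insertI1)
    ultimately have "arg_min_on ?f (set us) = p" using eq(3) by auto
    then have "?f p \<le> ?f (axis_point 1)"
      using arg_min_least[of "set us" "axis_point 1" ?f] tip by fastforce
    then show False using tip_beats_apex[OF V s _ r] eq by force
  qed simp
  also have "\<dots> \<le> (1 - ?p) ^ l" by (rule prob_replicate_pmf_avoid)
  also have "\<dots> \<le> exp (- ?p) ^ l"
    using pmf_le_1[of ?D] exp_ge_add_one_self[of "- ?p"] by (intro power_mono) auto
  also have "\<dots> = exp (- (real l * ?p))" by (simp flip: exp_of_nat_mult)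
  also have "\<dots> \<le> exp (- (real l * (1 / (8 * a\<^sup>2 * ?r))))"
    using mult_left_mono[OF pmf_tip_ge[OF V s r1], of "real l"] by simp
  finally show ?thesis by simp
qed

text \<open>There are exactly as many steps left as missing apexes, so every step must add a new
  apex and the bounds for the single steps multiply to the exponential of the hazard.\<close>

lemma prob_all_apexes_le:
  assumes "V \<subseteq> apexes" and s: "s \<in> offsets" and l: "l \<ge> 1"
  shows "measure_pmf.prob (greedy_iter l points (card (apexes - V)) (insert (axis_point s) V))
      {C. apexes \<subseteq> C} \<le> exp (- hazard l (card (apexes - V)))"
  using assms(1)
proof (induction "card (apexes - V)" arbitrary: V)
  case 0
  have hazard_0: "hazard l 0 = 0"
  proof -
    have "{m. 3 * a \<le> real m \<and> m \<le> 0} = {}" using a_ge by auto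
    then show ?thesis by (simp only: hazard_def) simp
  qed
  show ?case unfolding 0(1)[symmetric] by (simp add: hazard_0)
next
  case (Suc r)
  let ?C = "insert (axis_point s) V"
  let ?G = "{insert p ?C |p. p \<in> apexes - V}"
  have finV: "finite ?C" using Suc.prems card_apexes finite_subset by auto
  have CX: "?C \<subseteq> points" using Suc.prems s by (auto simp: points_def)
  \<comment> \<open>Below the threshold the tip need not win, and the bound is the trivial
    \<open>exp 0 = 1\<close>.\<close>
  have step: "measure_pmf.prob (greedy_step l points ?C) ?G \<le>
      exp (- (if 3 * a \<le> real (Suc r) then real l / (8 * a\<^sup>2 * real (Suc r)) else 0))"
    using prob_choose_apex_le[OF Suc.prems s l] Suc.hyps(2) by auto
  have "measure_pmf.prob (bind_pmf (greedy_step l points ?C) (greedy_iter l points r))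
      {C. apexes \<subseteq> C} \<le>
      exp (- hazard l r) * measure_pmf.prob (greedy_step l points ?C) ?G"
  proof (rule prob_bind_pmf_le)
    fix C' assume "C' \<in> ?G"
    then obtain p where p: "p \<in> apexes - V" "C' = insert (axis_point s) (insert p V)" by blast
    have "apexes - insert p V = (apexes - V) - {p}" by auto
    then have "r = card (apexes - insert p V)"
      using p card_apexes(1) Suc.hyps(2) by simp
    then show "measure_pmf.prob (greedy_iter l points r C') {C. apexes \<subseteq> C} \<le> exp (- hazard l r)"
      using Suc.hyps(1)[of "insert p V"] p Suc.prems by auto
  next
    fix C' assume C': "C' \<in> set_pmf (greedy_step l points ?C)" "C' \<notin> ?G"
    obtain u where u: "u \<in> points" "C' = insert u ?C"
      using set_pmf_greedy_step[OF points(1,2) finV _ l C'(1)] by blast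
    have sub: "C' \<subseteq> points" "C' \<noteq> {}" using u CX by auto
    \<comment> \<open>A wasted step leaves \<open>r + 1\<close> missing apexes for \<open>r\<close>
      steps.\<close>
    have "u \<notin> apexes - V" using C'(2) u by blast
    then have un: "apexes - C' = apexes - V" using u axis_point_not_apex by auto
    have "\<not> apexes \<subseteq> C''" if "C'' \<in> set_pmf (greedy_iter l points r C')" for C''
    proof
      assume all: "apexes \<subseteq> C''"
      have C'': "C'' \<subseteq> points" "card (C'' - C') \<le> r"
        using set_pmf_greedy_iter[OF points(1,2) sub l that] by auto
      have "finite C''" using C'' points(1) finite_subset by blast
      then have "card (apexes - C') \<le> card (C'' - C')" using all by (intro card_mono) auto
      then show False using C'' un Suc.hyps(2) by simp
    qed
    then show "measure_pmf.prob (greedy_iter l points r C') {C. apexes \<subseteq> C} = 0"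
      by (auto simp: measure_pmf_zero_iff)
  qed
  also have "\<dots> \<le> exp (- hazard l r) *
      exp (- (if 3 * a \<le> real (Suc r) then real l / (8 * a\<^sup>2 * real (Suc r)) else 0))"
    using step by (intro mult_left_mono) auto
  also have "\<dots> = exp (- hazard l (Suc r))"
    by (simp add: hazard_Suc flip: exp_add)
  finally show ?case by (simp add: greedy_iter_Suc flip: Suc.hyps(2))
qed

section \<open>From a missed apex to expected cost and optimum\<close>

lemma missed_apex_cost:
  assumes "C \<subseteq> points" "C \<noteq> {}" "\<not> apexes \<subseteq> C"
  shows "a\<^sup>2 \<le> kmeans_cost points C"
proof -
  have fin: "finite C" using assms points finite_subset by blast
  obtain p where p: "p \<in> apexes" "p \<notin> C" using assms by blast
  have "a\<^sup>2 \<le> center_sqdist C p"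
  proof (rule center_sqdist_geI[OF fin assms(2)])
    fix c assume c: "c \<in> C"
    then have "(\<exists>s. c = axis_point s) \<or> (c \<in> apexes \<and> p \<noteq> c)"
      using assms(1) p by (auto simp: points_def)
    then show "a\<^sup>2 \<le> sqdist p c" using apex_sqdists[OF p(1)] by auto
  qed
  also have "\<dots> \<le> kmeans_cost points C"
    unfolding kmeans_cost_def using p points center_sqdist_nonneg[OF fin assms(2)]
    by (intro member_le_sum) (auto simp: points_def)
  finally show ?thesis .
qed

text \<open>The cluster holds \<open>k\<close> of the \<open>2 * k\<close> points, hence the factor
  1/2. After a start in it, \<open>k - 1\<close> steps remain for \<open>k - 1\<close>
  apexes.\<close>

lemma prob_missed_apex_ge:
  assumes l: "l \<ge> 1"
  shows "(1 - exp (- hazard l (k - 1))) / 2 \<le>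
    measure_pmf.prob (greedy_kmeanspp k l points) {C. \<not> apexes \<subseteq> C}"
proof -
  have "(1 - exp (- hazard l (k - 1))) *
      measure_pmf.prob (pmf_of_set points) (axis_point ` offsets) \<le>
    measure_pmf.prob (greedy_kmeanspp k l points) {C. \<not> apexes \<subseteq> C}"
    unfolding greedy_kmeanspp_eq
  proof (rule prob_bind_pmf_ge)
    fix c assume "c \<in> axis_point ` offsets"
    then obtain s where s: "s \<in> offsets" "c = axis_point s" by auto
    let ?M = "greedy_iter l points (k - 1) {c}"
    have "measure_pmf.prob ?M {C. apexes \<subseteq> C} \<le> exp (- hazard l (k - 1))"
      using prob_all_apexes_le[of "{}" s l] s l card_apexes by simp
    moreover have "{C. \<not> apexes \<subseteq> C} = space (measure_pmf ?M) - {C. apexes \<subseteq> C}" by auto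
    then have "measure_pmf.prob ?M {C. \<not> apexes \<subseteq> C} = 1 - measure_pmf.prob ?M {C. apexes \<subseteq> C}"
      by (simp only:) (rule measure_pmf.prob_compl, simp)
    ultimately show "1 - exp (- hazard l (k - 1)) \<le> measure_pmf.prob ?M {C. \<not> apexes \<subseteq> C}"
      by linarith
  qed
  moreover have "measure_pmf.prob (pmf_of_set points) (axis_point ` offsets) = 1 / 2"
  proof -
    have "points \<inter> axis_point ` offsets = axis_point ` offsets" by (auto simp: points_def)
    moreover have "card (axis_point ` offsets) = k"
      using card_offsets by (subst card_image) (auto simp: inj_on_def axis_point_inj)
    ultimately show ?thesis
      using points card_points k_ge by (simp add: measure_pmf_of_set)
  qed
  ultimately show ?thesis by simp
qed

lemma expected_cost_ge:
  assumes l: "l \<ge> 1"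
  shows "a\<^sup>2 * (1 - exp (- hazard l (k - 1))) / 2 \<le>
    measure_pmf.expectation (greedy_kmeanspp k l points) (kmeans_cost points)"
proof -
  let ?M = "greedy_kmeanspp k l points"
  have supp: "C \<subseteq> points \<and> C \<noteq> {}" if C: "C \<in> set_pmf ?M" for C
  proof -
    obtain c where "c \<in> points" "C \<in> set_pmf (greedy_iter l points (k - 1) {c})"
      using C points by (auto simp: greedy_kmeanspp_eq)
    then show ?thesis using set_pmf_greedy_iter[OF points(1,2) _ _ l, of "{c}" C] by blast
  qed
  \<comment> \<open>Finite support makes the cost integrable; otherwise the integral would default
    to 0.\<close>
  have "set_pmf ?M \<subseteq> Pow points" using supp by blast
  then have "finite (set_pmf ?M)"
    using points(1) finite_subset by blast
  then have int: "integrable ?M f" for f :: "real vec set \<Rightarrow> real"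
    by (rule integrable_measure_pmf_finite)
  have "a\<^sup>2 * ((1 - exp (- hazard l (k - 1))) / 2) \<le>
      a\<^sup>2 * measure_pmf.prob ?M {C. \<not> apexes \<subseteq> C}"
    using prob_missed_apex_ge[OF l] by (intro mult_left_mono) auto
  also have "\<dots> = measure_pmf.expectation ?M (\<lambda>C. a\<^sup>2 * indicator {C. \<not> apexes \<subseteq> C} C)"
    by simp
  also have "\<dots> \<le> measure_pmf.expectation ?M (kmeans_cost points)"
  proof (rule integral_mono_AE[OF int int], unfold AE_measure_pmf_iff, rule ballI)
    fix C assume "C \<in> set_pmf ?M"
    then have C: "C \<subseteq> points" "C \<noteq> {}" using supp by auto
    then have "finite C" using points(1) finite_subset by blast
    then show "a\<^sup>2 * indicator {C. \<not> apexes \<subseteq> C} C \<le> kmeans_cost points C"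
      using missed_apex_cost[OF C] kmeans_cost_nonneg[of C points] C by (auto simp: indicator_def)
  qed
  finally show ?thesis by simp
qed

text \<open>Positivity, due to \<open>2 * k > k\<close> distinct points, keeps the ratio clear of
  the convention \<open>x / 0 = 0\<close>. With the origin and all apexes as centers, the cluster
  costs at most 1 and the tip 1.\<close>

lemma opt_bounds: "0 < kmeans_opt k k points" "kmeans_opt k k points \<le> 2"
proof -
  let ?C = "insert (axis_point 0) apexes"
  have C: "?C \<subseteq> carrier_vec k" "finite ?C" "card ?C = k"
    using carrier card_apexes axis_point_not_apex k_ge by (auto simp: apexes_def)
  show "0 < kmeans_opt k k points"
    using kmeans_opt_pos[OF points(1,3) _ _ C] card_points k_ge by simp
  have 0: "0 \<in> offsets" using k_ge by (auto simp: offsets_def intro!: image_eqI[of _ _ 0])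
  have "kmeans_opt k k points \<le> kmeans_cost points ?C"
    using C k_ge by (intro kmeans_opt_le) auto
  also have "\<dots> \<le> 2" using cost_eq[of apexes 0] offsets_cost_le[OF 0] by simp
  finally show "kmeans_opt k k points \<le> 2" .
qed

section \<open>Choice of the scale and the constants\<close>

lemma hazard_ge:
  assumes M: "3 * a \<le> real M" "M \<le> k"
  shows "real l / (8 * a\<^sup>2) * (ln (real k) - ln (real M)) \<le> hazard l (k - 1)"
proof -
  have "1 \<le> M" using M a_ge by linarith
  then have "ln (real k) - ln (real M) \<le> (\<Sum>m = M..<k. 1 / real m)"
    using M by (intro harmonic_segment_ge)
  also have "\<dots> \<le> (\<Sum>m | 3 * a \<le> real m \<and> m \<le> k - 1. 1 / real m)"
    using M by (intro sum_mono2) auto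
  finally show ?thesis unfolding hazard_def by (intro mult_left_mono) auto
qed

end

text \<open>The harmonic sum starts at about \<open>3 * a\<close>; it keeps a constant fraction of
  \<open>ln k\<close> because \<open>M\<close> is at most \<open>k\<close> to a power below
  1.\<close>

lemma apex_scale_threshold:
  fixes k :: nat and a :: real
  assumes k: "k \<ge> 4" and a: "a = 1 \<or> 1 \<le> a \<and> 64 * a\<^sup>2 \<le> real k"
  obtains M where "3 * a \<le> real M" "M \<le> k" "ln (real k) / 5 \<le> ln (real k) - ln (real M)"
  using a
proof (elim disjE)
  assume a: "a = 1"
  \<comment> \<open>The fraction 1/5 comes from the smallest case \<open>k = 4\<close>,
    \<open>M = 3\<close>: 243 is at most 256.\<close>
  have "(3::real) ^ 5 \<le> real k ^ 4"
    using power_mono[of 4 "real k" 4] k by simp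
  then have "ln ((3::real) ^ 5) \<le> ln (real k ^ 4)" using k by (subst ln_le_cancel_iff) auto
  moreover have "ln ((3::real) ^ 5) = 5 * ln 3" "ln (real k ^ 4) = 4 * ln (real k)"
    using k by (subst ln_realpow; simp)+
  ultimately have "5 * ln 3 \<le> 4 * ln (real k)" by linarith
  then show ?thesis using that[of 3] a k by simp
next
  assume a: "1 \<le> a \<and> 64 * a\<^sup>2 \<le> real k"
  \<comment> \<open>Rounding up costs at most 1, so \<open>M \<le> 4 * a\<close> and
    \<open>M\<^sup>2 \<le> 16 * a\<^sup>2 \<le> k\<close>, which leaves half of
    \<open>ln k\<close>.\<close>
  define M where "M = nat \<lceil>3 * a\<rceil>"
  have lo: "3 * a \<le> real M" unfolding M_def by linarith
  have hi: "real M \<le> 4 * a" using a unfolding M_def by linarith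
  have "(real M)\<^sup>2 \<le> (4 * a)\<^sup>2" using hi by (intro power_mono) auto
  also have "\<dots> \<le> real k" using a zero_le_power2[of a]
    by (simp add: power_mult_distrib del: zero_le_power2)
  finally have sq: "(real M)\<^sup>2 \<le> real k" .
  have M1: "1 \<le> real M" using lo a by linarith
  then have "ln ((real M)\<^sup>2) \<le> ln (real k)" using sq k by (subst ln_le_cancel_iff) auto
  then have "2 * ln (real M) \<le> ln (real k)" using M1 by (simp add: ln_realpow)
  moreover have "0 \<le> ln (real k)" using k by simp
  ultimately have "ln (real k) / 5 \<le> ln (real k) - ln (real M)" by linarith
  moreover have "real M \<le> real k"
    using sq mult_left_mono[OF M1, of "real M"] by (simp add: power2_eq_square)
  ultimately show ?thesis using that lo by auto
qed

theorem theorem1: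
  "\<exists>c::real. c > 0 \<and>
    (\<forall>k::nat. k \<ge> 4 \<longrightarrow> (\<forall>l::nat. l \<ge> 1 \<longrightarrow>
      (\<exists>X::real vec set. finite X \<and> X \<subseteq> carrier_vec k \<and>
        measure_pmf.expectation (greedy_kmeanspp k l X) (kmeans_cost X) / kmeans_opt k k X
          \<ge> c * (min (real l) (real k / ln (real k)) * ln (real k)))))"
proof (intro exI[of _ "1 / 416 :: real"] conjI allI impI)
  fix k l :: nat assume k: "k \<ge> 4" and l: "l \<ge> 1"
  define B where "B = min (real l) (real k / ln (real k)) * ln (real k)"
  \<comment> \<open>The cutoff at 1 provides \<open>a \<ge> 1\<close>. Where it is inactive,
    \<open>64 * a\<^sup>2 = B \<le> k\<close>, as \<open>apex_scale_threshold\<close>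
    demands.\<close>
  define a where "a = sqrt (max 1 (B / 64))"
  have lnk: "0 < ln (real k)" using k by simp
  have B: "0 \<le> B" "B \<le> real l * ln (real k)" "B \<le> real k"
  proof -
    show "0 \<le> B" using lnk by (simp add: B_def)
    show "B \<le> real l * ln (real k)" unfolding B_def using lnk by (intro mult_right_mono) auto
    have "B \<le> real k / ln (real k) * ln (real k)"
      unfolding B_def using lnk by (intro mult_right_mono) auto
    then show "B \<le> real k" using lnk by simp
  qed
  have a2: "a\<^sup>2 = max 1 (B / 64)" by (simp add: a_def)
  have a1: "1 \<le> a" by (simp add: a_def)
  interpret hard_instance k a using k a1 by unfold_locales
  have "a = 1 \<or> 1 \<le> a \<and> 64 * a\<^sup>2 \<le> real k"
    using a1 a2 B(3) by (cases "B / 64 \<le> 1") (auto simp: a_def max_def)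
  then obtain M where M: "3 * a \<le> real M" "M \<le> k" "ln (real k) / 5 \<le> ln (real k) - ln (real M)"
    using apex_scale_threshold[OF k] by blast
  \<comment> \<open>This is the lower bound \<open>l / (8 * a\<^sup>2) * (ln k / 5)\<close> for the
    hazard with \<open>l * ln k\<close> weakened to \<open>B\<close>, so that \<open>x\<close> stays
    bounded.\<close>
  define x where "x = B / (40 * a\<^sup>2)"
  have x0: "0 \<le> x" using B by (simp add: x_def)
  have a2pos: "0 < a\<^sup>2" using a1 by simp
  have "B \<le> 64 * a\<^sup>2" using a2 by simp
  then have x1: "x \<le> 8 / 5" using a2pos by (simp add: x_def field_simps)
  have "x \<le> real l * ln (real k) / (40 * a\<^sup>2)"
    unfolding x_def using B by (intro divide_right_mono) auto
  also have "\<dots> = real l / (8 * a\<^sup>2) * (ln (real k) / 5)" by simp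
  also have "\<dots> \<le> real l / (8 * a\<^sup>2) * (ln (real k) - ln (real M))"
    using M(3) by (intro mult_left_mono) auto
  also have "\<dots> \<le> hazard l (k - 1)" using M by (intro hazard_ge)
  finally have hz: "x \<le> hazard l (k - 1)" .
  \<comment> \<open>Since \<open>1 + x\<close> is at most 13/5, the bound becomes linear in
    \<open>x\<close>; multiplied by \<open>a\<^sup>2\<close> it no longer depends on
    \<open>a\<close>. The start in the cluster and the optimum each cost a further factor 2, taking
    104 to 416.\<close>
  have "x / (13 / 5) \<le> x / (1 + x)" using x0 x1 by (intro divide_left_mono) auto
  also have "\<dots> \<le> 1 - exp (- x)" using x0 by (rule one_minus_exp_ge)
  also have "\<dots> \<le> 1 - exp (- hazard l (k - 1))" using hz by simp
  finally have "a\<^sup>2 * (x / (13 / 5)) \<le> a\<^sup>2 * (1 - exp (- hazard l (k - 1)))"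
    by (intro mult_left_mono) auto
  moreover have "a\<^sup>2 * (x / (13 / 5)) = B / 104" using a2pos by (simp add: x_def field_simps)
  ultimately have E: "B / 208 \<le>
      measure_pmf.expectation (greedy_kmeanspp k l points) (kmeans_cost points)"
    using expected_cost_ge[OF l] by linarith
  have "(B / 208) / 2 \<le> measure_pmf.expectation (greedy_kmeanspp k l points) (kmeans_cost points) /
      kmeans_opt k k points"
    using E B opt_bounds by (intro frac_le) auto
  then show "\<exists>X::real vec set. finite X \<and> X \<subseteq> carrier_vec k \<and>
        measure_pmf.expectation (greedy_kmeanspp k l X) (kmeans_cost X) / kmeans_opt k k X
          \<ge> 1 / 416 * (min (real l) (real k / ln (real k)) * ln (real k))"
    using points by (intro exI[of _ points]) (simp add: B_def)
qed simp

end
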